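(* Let $G$ be the planar graph with vertex set $\{0,1,\dots,8\}$ and the following $21$ edges: $\{7,1\}, \{1,2\}, \{2,3\}, \{7,6\}, \{6,1\}, \{1,8\}, \{8,2\}, \{2,4\}, \{4,3\}, \{6,8\}, \{8,4\}, \{6,5\}, \{8,5\}, \{4,5\}$, and $\{0,i\}$ for each $i \in \{1,2,3,4,5,6,7\}$. Then $\operatorname{diam}(\mathcal{I}(G)) \geq 5$.
   Context: In an orientation $\vec{G}$ of a graph $G$, the inversion of a set $X \subseteq V(G)$ consists in reversing all arcs with both endvertices in $X$. The inversion graph $\mathcal{I}(G)$ is the graph whose vertices are the labelled orientations of $G$, two orientations being adjacent if and only if the inversion of some $X\subseteq V(G)$ transforms one into the other; $\operatorname{diam}(\mathcal{I}(G))$ is its diameter. *)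

theory Defs
  imports
    "HOL-Analysis.Analysis"
    "Graph_Theory.Pair_Digraph"
    "Graph_Theory.Shortest_Path"
begin

text \<open>
  A finite simple graph is a \<^locale>\<open>pair_graph\<close>: a loop-free symmetric digraph, in which the
  edge \<open>{u, v}\<close> is represented by the two pairs \<open>(u, v)\<close> and \<open>(v, u)\<close>.
\<close>

definition orientation_of :: "'a pair_pre_digraph \<Rightarrow> 'a pair_pre_digraph \<Rightarrow> bool" where
  "orientation_of G D \<longleftrightarrow>
     pverts D = pverts G \<and> parcs D \<subseteq> parcs G \<and>
     (\<forall>(u, v) \<in> parcs G. (u, v) \<in> parcs D \<longleftrightarrow> (v, u) \<notin> parcs D)"

definition inversion :: "'a set \<Rightarrow> 'a pair_pre_digraph \<Rightarrow> 'a pair_pre_digraph" where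
  "inversion X D =
     \<lparr> pverts = pverts D,
       parcs = {(u, v) \<in> parcs D. \<not> (u \<in> X \<and> v \<in> X)} \<union>
               {(v, u) | u v. (u, v) \<in> parcs D \<and> u \<in> X \<and> v \<in> X} \<rparr>"

text \<open>
  The requirement \<open>D \<noteq> D'\<close> only removes loops, coming from sets that do not contain both
  endvertices of any edge.
\<close>

definition inversion_graph :: "'a pair_pre_digraph \<Rightarrow> 'a pair_pre_digraph pair_pre_digraph" where
  "inversion_graph G =
     \<lparr> pverts = {D. orientation_of G D},
       parcs = {(D, D'). orientation_of G D \<and> orientation_of G D' \<and> D \<noteq> D' \<and>
                         (\<exists>X \<subseteq> pverts G. inversion X D = D')} \<rparr>"

text \<open>
  Distances are the library's \<open>\<mu>\<close> with every arc of cost \<open>1\<close>; they are \<open>\<infinity>\<close> between vertices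
  that are not connected by a walk.
\<close>

definition graph_diameter :: "'a pair_pre_digraph \<Rightarrow> ereal" where
  "graph_diameter G =
     (SUP (u, v) \<in> pverts G \<times> pverts G. wf_digraph.\<mu> (with_proj G) (\<lambda>_. 1) u v)"

text \<open>
  A plane drawing: \<open>p\<close> places the vertices, and the two orientations \<open>(u, v)\<close>, \<open>(v, u)\<close> of an edge
  are drawn as the same simple arc. By the first clause on images an arc meets the drawn vertices
  only in its own ends, so by the last clause distinct edges meet only in common ends.
\<close>

definition planar_graph :: "'a pair_pre_digraph \<Rightarrow> bool" where
  "planar_graph G \<longleftrightarrow>
     (\<exists>(p :: 'a \<Rightarrow> complex) (c :: 'a \<times> 'a \<Rightarrow> real \<Rightarrow> complex).
        inj_on p (pverts G) \<and>
        (\<forall>(u, v) \<in> parcs G.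
           arc (c (u, v)) \<and> pathstart (c (u, v)) = p u \<and> pathfinish (c (u, v)) = p v \<and>
           path_image (c (v, u)) = path_image (c (u, v)) \<and>
           path_image (c (u, v)) \<inter> p ` pverts G = {p u, p v}) \<and>
        (\<forall>(u, v) \<in> parcs G. \<forall>(x, y) \<in> parcs G. {u, v} \<noteq> {x, y} \<longrightarrow>
           path_image (c (u, v)) \<inter> path_image (c (x, y)) \<subseteq> p ` pverts G))"

definition G21_edges :: "(nat \<times> nat) list" where
  "G21_edges =
     [(7, 1), (1, 2), (2, 3), (7, 6), (6, 1), (1, 8), (8, 2), (2, 4), (4, 3), (6, 8), (8, 4),
      (6, 5), (8, 5), (4, 5),
      (0, 1), (0, 2), (0, 3), (0, 4), (0, 5), (0, 6), (0, 7)]"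

definition G21 :: "nat pair_pre_digraph" where
  "G21 = \<lparr> pverts = {0..8}, parcs = set G21_edges \<union> (set G21_edges)\<inverse> \<rparr>"


section \<open>Sanity checks\<close>

lemma pair_graph_G21: "pair_graph G21"
  by unfold_locales (auto simp: G21_def G21_edges_def symmetric_def sym_def)

lemma card_edges_G21: "card {{u, v} | u v. (u, v) \<in> parcs G21} = 21"
proof -
  have "{{u, v} | u v. (u, v) \<in> parcs G21} = set (map (\<lambda>(u, v). {u, v}) G21_edges)"
    by (force simp: G21_def image_iff split: prod.splits)
  moreover have "distinct (map (\<lambda>(u, v). {u, v}) G21_edges)"
    by (simp add: G21_edges_def doubleton_eq_iff)
  ultimately show ?thesis
    using distinct_card by (fastforce simp: G21_edges_def)
qed

lemma inversion_inversion:
  "inversion X (inversion X D) = D"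
  by (cases D) (auto simp: inversion_def)

lemma orientation_of_inversion:
  assumes "pair_graph G" "orientation_of G D"
  shows "orientation_of G (inversion X D)"
proof -
  interpret pair_graph G by fact
  have s: "(v, u) \<in> parcs G" if "(u, v) \<in> parcs G" for u v
    using pair_sym_arcs that by (auto simp: symmetric_def sym_def)
  show ?thesis
    using assms(2) s unfolding orientation_of_def inversion_def by fastforce
qed

lemma pair_graph_inversion_graph:
  assumes "pair_graph G"
  shows "pair_graph (inversion_graph G)"
proof -
  interpret pair_graph G by fact
  have "{D. orientation_of G D} \<subseteq>
        (\<lambda>A. \<lparr>pverts = pverts G, parcs = A\<rparr>) ` Pow (parcs G)"
  proof
    fix D assume "D \<in> {D. orientation_of G D}"
    then have "D = \<lparr>pverts = pverts G, parcs = parcs D\<rparr>" "parcs D \<in> Pow (parcs G)"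
      by (auto simp: orientation_of_def)
    then show "D \<in> (\<lambda>A. \<lparr>pverts = pverts G, parcs = A\<rparr>) ` Pow (parcs G)"
      by blast
  qed
  then have fin: "finite {D. orientation_of G D}"
    using pair_finite_arcs by (meson finite_Pow_iff finite_imageI finite_subset)
  have "parcs (inversion_graph G) \<subseteq> {D. orientation_of G D} \<times> {D. orientation_of G D}"
    by (auto simp: inversion_graph_def)
  then have fin': "finite (parcs (inversion_graph G))"
    using fin by (meson finite_SigmaI finite_subset)
  show ?thesis
    by unfold_locales
      (use fin fin' in \<open>auto simp: inversion_graph_def symmetric_def sym_def inversion_inversion\<close>)
qed


section \<open>A straight-line plane drawing\<close>

text \<open>
  \<open>G21_pos\<close> below places the nine vertices on integer points, no three of them collinear, so that
  the straight-line drawing has no crossings.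
\<close>

definition cross3 :: "complex \<Rightarrow> complex \<Rightarrow> complex \<Rightarrow> real" where
  "cross3 p q r = (Re q - Re p) * (Im r - Im p) - (Im q - Im p) * (Re r - Re p)"

lemma cross3_closed_segment:
  assumes "z \<in> closed_segment r s"
  obtains t where "0 \<le> t" "t \<le> 1" "z = (1 - t) *\<^sub>R r + t *\<^sub>R s"
    "cross3 p q z = (1 - t) * cross3 p q r + t * cross3 p q s"
proof -
  from assms obtain t where t: "0 \<le> t" "t \<le> 1" "z = (1 - t) *\<^sub>R r + t *\<^sub>R s"
    unfolding closed_segment_def by blast
  have "cross3 p q z = (1 - t) * cross3 p q r + t * cross3 p q s"
    unfolding cross3_def t(3) by (simp add: algebra_simps)
  with t show ?thesis using that by blast
qed

lemma cross3_on_line: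
  assumes "z \<in> closed_segment p q"
  shows "cross3 p q z = 0"
  by (rule cross3_closed_segment[OF assms, of p q]) (simp add: cross3_def)

lemma closed_segments_disjoint:
  assumes "0 < cross3 p q r * cross3 p q s"
  shows "closed_segment p q \<inter> closed_segment r s = {}"
proof (rule ccontr)
  assume "\<not> ?thesis"
  then obtain z where z: "z \<in> closed_segment p q" "z \<in> closed_segment r s" by auto
  obtain t where t: "0 \<le> t" "t \<le> 1"
    "cross3 p q z = (1 - t) * cross3 p q r + t * cross3 p q s"
    using cross3_closed_segment[OF z(2)] by blast
  have "0 = ((1 - t) * cross3 p q r + t * cross3 p q s) * cross3 p q r"
    using cross3_on_line[OF z(1)] t by simp
  also have "\<dots> = (1 - t) * (cross3 p q r)\<^sup>2 + t * (cross3 p q r * cross3 p q s)"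
    by (simp add: algebra_simps power2_eq_square)
  also have "\<dots> > 0"
  proof (cases "t = 0")
    case True
    then show ?thesis using assms by auto
  next
    case False
    then show ?thesis using assms t by (intro add_nonneg_pos) auto
  qed
  finally show False by simp
qed

lemma closed_segments_common_end:
  assumes "cross3 p q s \<noteq> 0"
  shows "closed_segment p q \<inter> closed_segment p s \<subseteq> {p}"
proof
  fix z assume z: "z \<in> closed_segment p q \<inter> closed_segment p s"
  then obtain t where t: "z = (1 - t) *\<^sub>R p + t *\<^sub>R s"
    "cross3 p q z = (1 - t) * cross3 p q p + t * cross3 p q s"
    using cross3_closed_segment by blast
  have "t = 0"
    using t(2) cross3_on_line z assms by (auto simp: cross3_def)
  then show "z \<in> {p}" using t(1) by simp
qed

definition G21_pos :: "nat \<Rightarrow> int \<times> int" where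
  "G21_pos i = [(6, 3), (3, 5), (4, 6), (5, 5), (7, 7), (8, 7), (6, 0), (5, 2), (0, 8)] ! i"

definition G21_cross :: "nat \<Rightarrow> nat \<Rightarrow> nat \<Rightarrow> int" where
  "G21_cross i j k =
     (case G21_pos i of (a, b) \<Rightarrow> case G21_pos j of (c, d) \<Rightarrow> case G21_pos k of (e, f) \<Rightarrow>
        (c - a) * (f - b) - (d - b) * (e - a))"

definition G21_point :: "nat \<Rightarrow> complex" where
  "G21_point i = Complex (of_int (fst (G21_pos i))) (of_int (snd (G21_pos i)))"

lemma cross3_G21: "cross3 (G21_point i) (G21_point j) (G21_point k) = of_int (G21_cross i j k)"
  by (simp add: cross3_def G21_point_def G21_cross_def split: prod.splits)

lemma G21_general_position:
  assumes "i \<in> {0..8}" "j \<in> {0..8}" "k \<in> {0..8}" "i \<noteq> j" "i \<noteq> k" "j \<noteq> k"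
  shows "G21_cross i j k \<noteq> 0"
proof -
  have "list_all (\<lambda>i. list_all (\<lambda>j. list_all (\<lambda>k.
          i = j \<or> i = k \<or> j = k \<or> G21_cross i j k \<noteq> 0) [0..<9]) [0..<9]) [0..<9]"
    by code_simp
  moreover have "i \<in> set [0..<9]" "j \<in> set [0..<9]" "k \<in> set [0..<9]"
    using assms(1-3) by auto
  ultimately show ?thesis using assms(4-6) unfolding list_all_iff by blast
qed

lemma G21_separated:
  assumes "(u, v) \<in> set G21_edges" "(x, y) \<in> set G21_edges" "{u, v} \<inter> {x, y} = {}"
  shows "0 < G21_cross u v x * G21_cross u v y \<or> 0 < G21_cross x y u * G21_cross x y v"
proof -
  have "list_all (\<lambda>(u, v). list_all (\<lambda>(x, y).
          u = x \<or> u = y \<or> v = x \<or> v = y \<or>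
          0 < G21_cross u v x * G21_cross u v y \<or>
          0 < G21_cross x y u * G21_cross x y v) G21_edges) G21_edges"
    by code_simp
  then show ?thesis using assms by (fastforce simp: list_all_iff)
qed

lemma planar_graph_G21: "planar_graph G21"
proof -
  let ?P = G21_point
  let ?S = "\<lambda>u v. closed_segment (?P u) (?P v)"
  interpret G: pair_graph G21 by (rule pair_graph_G21)
  have V: "pverts G21 = {0..8}" by (simp add: G21_def)
  have arcD: "u \<in> {0..8}" "v \<in> {0..8}" "u \<noteq> v" if "(u, v) \<in> parcs G21" for u v
    using G.in_arcsD1[OF that] G.in_arcsD2[OF that] G.pair_no_loops[OF that] by (auto simp: V)
  have inj: "?P u \<noteq> ?P v" if uv: "u \<in> {0..8}" "v \<in> {0..8}" "u \<noteq> v" for u v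
  proof
    assume eq: "?P u = ?P v"
    have "card {u, v} < card {0..8::nat}" using uv by simp
    then obtain w where "w \<in> {0..8}" "w \<notin> {u, v}"
      by (metis card_mono finite.emptyI finite_insert linorder_not_less subsetI)
    then have "cross3 (?P u) (?P v) (?P w) \<noteq> 0"
      using G21_general_position[of u v w] uv by (auto simp: cross3_G21)
    with eq show False by (simp add: cross3_def)
  qed
  have vert: "w \<in> {u, v}" if "(u, v) \<in> parcs G21" "w \<in> {0..8}" "?P w \<in> ?S u v" for u v w
    using G21_general_position[of u v w] cross3_on_line[OF that(3)] arcD[OF that(1)] that(2)
    by (auto simp: cross3_G21)
  have disj: "?S u v \<inter> ?S x y = {}"
    if a: "(u, v) \<in> parcs G21" "(x, y) \<in> parcs G21" "{u, v} \<inter> {x, y} = {}" for u v x y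
  proof -
    have main: "?S a b \<inter> ?S c d = {}"
      if h: "(a, b) \<in> set G21_edges" "(c, d) \<in> set G21_edges" "{a, b} \<inter> {c, d} = {}" for a b c d
    proof -
      have "0 < cross3 (?P a) (?P b) (?P c) * cross3 (?P a) (?P b) (?P d) \<or>
            0 < cross3 (?P c) (?P d) (?P a) * cross3 (?P c) (?P d) (?P b)"
        using G21_separated[OF h] unfolding cross3_G21 by (metis of_int_0_less_iff of_int_mult)
      then show ?thesis
        using closed_segments_disjoint by (metis Int_commute)
    qed
    have dir: "(u, v) \<in> set G21_edges \<or> (v, u) \<in> set G21_edges"
      "(x, y) \<in> set G21_edges \<or> (y, x) \<in> set G21_edges"
      using a by (auto simp: G21_def)
    show ?thesis
      using dir main[of u v x y] main[of u v y x] main[of v u x y] main[of v u y x] a(3)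
      by (auto simp: closed_segment_commute[of "?P v" "?P u"]
          closed_segment_commute[of "?P y" "?P x"])
  qed
  have common: "?S a b \<inter> ?S a d \<subseteq> {?P a}"
    if "(a, b) \<in> parcs G21" "(a, d) \<in> parcs G21" "b \<noteq> d" for a b d
    using closed_segments_common_end[of "?P a" "?P b" "?P d"] G21_general_position[of a b d]
      arcD[OF that(1)] arcD[OF that(2)] that(3) by (simp add: cross3_G21)
  have sym: "(v, u) \<in> parcs G21" if "(u, v) \<in> parcs G21" for u v
    using that by (auto simp: G21_def)
  have cross: "?S u v \<inter> ?S x y \<subseteq> ?P ` {0..8}"
    if a: "(u, v) \<in> parcs G21" "(x, y) \<in> parcs G21" "{u, v} \<noteq> {x, y}" for u v x y
  proof -
    consider "{u, v} \<inter> {x, y} = {}" | "u = x" "v \<noteq> y" | "u = y" "v \<noteq> x"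
      | "v = x" "u \<noteq> y" | "v = y" "u \<noteq> x"
      using a(3) by auto
    then show ?thesis
    proof cases
      case 1
      then show ?thesis using disj[OF a(1,2)] by simp
    next
      case 2
      then show ?thesis using common[of u v y] a arcD[OF a(1)] by blast
    next
      case 3
      then show ?thesis
        using common[of u v x] a sym arcD[OF a(1)] closed_segment_commute[of "?P x" "?P y"] by blast
    next
      case 4
      then show ?thesis
        using common[of v u y] a sym arcD[OF a(1)] closed_segment_commute[of "?P u" "?P v"] by blast
    next
      case 5
      then show ?thesis
        using common[of v u x] a sym arcD[OF a(1)] closed_segment_commute[of "?P u" "?P v"]
          closed_segment_commute[of "?P x" "?P y"] by blast
    qed
  qed
  show ?thesis
    unfolding planar_graph_def
  proof (intro exI[of _ ?P] exI[of _ "\<lambda>(u, v). linepath (?P u) (?P v)"] conjI)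
    show "inj_on ?P (pverts G21)"
      using inj unfolding inj_on_def V by blast
    have "?S u v \<inter> ?P ` {0..8} = {?P u, ?P v}" if "(u, v) \<in> parcs G21" for u v
    proof (intro equalityI subsetI)
      fix z assume "z \<in> ?S u v \<inter> ?P ` {0..8}"
      then obtain w where "w \<in> {0..8}" "z = ?P w" "?P w \<in> ?S u v" by blast
      then show "z \<in> {?P u, ?P v}" using vert[OF that, of w] by auto
    qed (use arcD[OF that] in auto)
    then show "\<forall>(u, v) \<in> parcs G21.
        arc ((\<lambda>(u, v). linepath (?P u) (?P v)) (u, v)) \<and>
        pathstart ((\<lambda>(u, v). linepath (?P u) (?P v)) (u, v)) = ?P u \<and>
        pathfinish ((\<lambda>(u, v). linepath (?P u) (?P v)) (u, v)) = ?P v \<and>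
        path_image ((\<lambda>(u, v). linepath (?P u) (?P v)) (v, u)) =
        path_image ((\<lambda>(u, v). linepath (?P u) (?P v)) (u, v)) \<and>
        path_image ((\<lambda>(u, v). linepath (?P u) (?P v)) (u, v)) \<inter> ?P ` pverts G21 = {?P u, ?P v}"
      using inj arcD by (auto simp: V closed_segment_commute intro!: arc_linepath)
    show "\<forall>(u, v) \<in> parcs G21. \<forall>(x, y) \<in> parcs G21. {u, v} \<noteq> {x, y} \<longrightarrow>
        path_image ((\<lambda>(u, v). linepath (?P u) (?P v)) (u, v)) \<inter>
        path_image ((\<lambda>(u, v). linepath (?P u) (?P v)) (x, y)) \<subseteq> ?P ` pverts G21"
      using cross by (simp add: V) blast
  qed
qed

end

theory Submission
  imports Defs
begin

text \<open>
  Performing the inversions of \<open>X\<^sub>1, \<dots>, X\<^sub>k\<close> reverses the edge \<open>{u, v}\<close> exactly when an odd number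
  of the \<open>X\<^sub>i\<close> contain both \<open>u\<close> and \<open>v\<close>. With \<open>x\<^sub>v \<in> GF(2)\<^sup>k\<close> the vector recording which
  \<open>X\<^sub>i\<close> contain \<open>v\<close>, this says \<open>x\<^sub>u \<cdot> x\<^sub>v = 1\<close>. So two orientations are at distance more than
  \<open>k\<close> as soon as no vectors \<open>x\<^sub>v \<in> GF(2)\<^sup>k\<close> have \<open>x\<^sub>u \<cdot> x\<^sub>v = 1\<close> on the edges where they differ and
  \<open>x\<^sub>u \<cdot> x\<^sub>v = 0\<close> on all other edges. For \<open>G21\<close> and \<open>k = 4\<close> this happens when they differ on
  \<open>03, 12, 17, 34, 56, 58\<close>; a computer search over all \<open>2\<^sup>2\<^sup>1\<close> sets of edges finds \<open>12\<close> such sets.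
\<close>

fun dot :: "bool list \<Rightarrow> bool list \<Rightarrow> bool" where
  "dot (a # x) (b # y) \<longleftrightarrow> (a \<and> b) \<noteq> dot x y"
| "dot _ _ \<longleftrightarrow> False"

text \<open>Zero coordinates contribute nothing, so shorter vectors can be padded to a prescribed
  length.\<close>

lemma dot_replicate_False: "dot (replicate n False @ x) (replicate n False @ y) = dot x y"
  by (induction n) auto

lemma orientation_ofI:
  assumes "pverts D = pverts G" "parcs D \<union> (parcs D)\<inverse> = parcs G" "parcs D \<inter> (parcs D)\<inverse> = {}"
  shows "orientation_of G D"
  unfolding orientation_of_def
proof (intro conjI ballI)
  fix e assume "e \<in> parcs G"
  then show "case e of (u, v) \<Rightarrow> (u, v) \<in> parcs D \<longleftrightarrow> (v, u) \<notin> parcs D"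
    using assms(2,3) by (cases e) auto
next
  show "parcs D \<subseteq> parcs G" using assms(2) by blast
qed (rule assms(1))

lemma arcs_fold_inversion:
  assumes "pair_graph G" "orientation_of G D" "(u, v) \<in> parcs G"
  shows "(u, v) \<in> parcs (fold inversion Xs D) \<longleftrightarrow>
    ((u, v) \<in> parcs D) \<noteq> dot (map (\<lambda>X. u \<in> X) Xs) (map (\<lambda>X. v \<in> X) Xs)"
  using assms(2)
proof (induction Xs arbitrary: D)
  case (Cons X Xs)
  \<comment> \<open>An orientation has exactly one of \<open>(u, v)\<close> and
    \<open>(v, u)\<close>, so reversing the edge toggles membership of
    \<open>(u, v)\<close>.\<close>
  have "(u, v) \<in> parcs (inversion X D) \<longleftrightarrow> ((u, v) \<in> parcs D) \<noteq> (u \<in> X \<and> v \<in> X)"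
    using Cons.prems assms(3) by (auto simp: orientation_of_def inversion_def)
  then show ?case
    using Cons.IH[OF orientation_of_inversion[OF assms(1) Cons.prems]] by auto
qed simp

lemma awalk_inversion_graph:
  assumes "pre_digraph.awalk (with_proj (inversion_graph G)) D p D'"
  obtains Xs where "length Xs = length p" "fold inversion Xs D = D'"
proof -
  have "\<exists>Xs. length Xs = length p \<and> fold inversion Xs D = D'"
    using assms
  proof (induction p arbitrary: D)
    case Nil
    then show ?case by (simp add: pre_digraph.awalk_def pre_digraph.cas.simps)
  next
    case (Cons e p)
    from Cons.prems obtain X where "inversion X D = snd e"
      and walk: "pre_digraph.awalk (with_proj (inversion_graph G)) (snd e) p D'"
      by (auto simp: pre_digraph.awalk_def pre_digraph.cas.simps inversion_graph_def)
    moreover obtain Xs where "length Xs = length p" "fold inversion Xs (snd e) = D'"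
      using Cons.IH[OF walk] by blast
    ultimately show ?case
      by (intro exI[of _ "X # Xs"]) simp
  qed
  then show ?thesis using that by blast
qed

lemma graph_diameter_inversion_graph_ge:
  assumes G: "pair_graph G" and D: "orientation_of G D" and D': "orientation_of G D'"
    and no_vectors: "\<nexists>x. (\<forall>v. length (x v) = k) \<and>
      (\<forall>(u, v) \<in> parcs G. dot (x u) (x v) \<longleftrightarrow> ((u, v) \<in> parcs D) \<noteq> ((u, v) \<in> parcs D'))"
  shows "graph_diameter (inversion_graph G) \<ge> ereal (Suc k)"
proof -
  interpret I: pair_graph "inversion_graph G" by (rule pair_graph_inversion_graph[OF G])
  have cost: "ereal (Suc k) \<le> I.awalk_cost (\<lambda>_. 1) p"
    if walk: "I.awalk D p D'" for p
  proof -
    obtain Xs where Xs: "length Xs = length p" "fold inversion Xs D = D'"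
      using awalk_inversion_graph[OF walk] .
    \<comment> \<open>The subtraction is truncated: these vectors have length \<open>k\<close>
      exactly when \<open>length p\<close> \<le> \<open>k\<close>, so a walk that short would
      contradict \<open>no_vectors\<close>.\<close>
    define x where
      "x v = replicate (k - length p) False @ map (\<lambda>X. v \<in> X) Xs" for v
    have "dot (x u) (x v) \<longleftrightarrow> ((u, v) \<in> parcs D) \<noteq> ((u, v) \<in> parcs D')"
      if "(u, v) \<in> parcs G" for u v
      using arcs_fold_inversion[OF G D that, of Xs]
      by (auto simp: x_def Xs(2) dot_replicate_False)
    then have "\<not> (\<forall>v. length (x v) = k)"
      using no_vectors by blast
    then have "k < length p"
      by (auto simp: x_def Xs(1))
    moreover have "I.awalk_cost (\<lambda>_. 1) p = length p"
      by (induction p) simp_all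
    ultimately show ?thesis by simp
  qed
  \<comment> \<open>If no walk joins \<open>D\<close> to \<open>D'\<close>, the infimum is
    \<infinity> and the bound is trivial.\<close>
  have "ereal (Suc k) \<le> I.\<mu> (\<lambda>_. 1) D D'"
    unfolding I.\<mu>_def by (rule INF_greatest) (use cost in blast)
  also have "\<dots> \<le> graph_diameter (inversion_graph G)"
  proof -
    have "(D, D') \<in> pverts (inversion_graph G) \<times> pverts (inversion_graph G)"
      using D D' by (simp add: inversion_graph_def)
    then show ?thesis
      unfolding graph_diameter_def
      by (rule SUP_upper2) (simp only: case_prod_conv order_refl)
  qed
  finally show ?thesis .
qed

text \<open>
  The vertices are nested in an order that keeps the exhaustive search small; \<open>3\<close> and \<open>7\<close> have
  degree three and are tested as soon as their neighbours are fixed.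
\<close>

definition G21_vectors_exist :: "bool list list \<Rightarrow> bool" where
  "G21_vectors_exist V \<longleftrightarrow>
    list_ex (\<lambda>x0.
    list_ex (\<lambda>x2. \<not> dot x0 x2 \<and>
    list_ex (\<lambda>x4. \<not> dot x0 x4 \<and> \<not> dot x2 x4 \<and>
    list_ex (\<lambda>x3. dot x0 x3 \<and> \<not> dot x2 x3 \<and> dot x4 x3) V \<and>
    list_ex (\<lambda>x1. \<not> dot x0 x1 \<and> dot x1 x2 \<and>
    list_ex (\<lambda>x8. \<not> dot x1 x8 \<and> \<not> dot x8 x2 \<and> \<not> dot x8 x4 \<and>
    list_ex (\<lambda>x5. \<not> dot x0 x5 \<and> dot x8 x5 \<and> \<not> dot x4 x5 \<and>
    list_ex (\<lambda>x6. \<not> dot x0 x6 \<and> \<not> dot x6 x1 \<and> \<not> dot x6 x8 \<and> dot x6 x5 \<and>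
    list_ex (\<lambda>x7. \<not> dot x0 x7 \<and> dot x7 x1 \<and> \<not> dot x7 x6) V) V) V) V) V) V) V) V"

text \<open>The list holds all 16 vectors of GF(2)^4, so the search is finite and is settled by
  evaluation.\<close>

lemma not_G21_vectors_exist: "\<not> G21_vectors_exist (List.n_lists 4 [False, True])"
  by code_simp

definition G21_flipped :: "(nat \<times> nat) set" where
  "G21_flipped = {(7, 1), (1, 2), (4, 3), (6, 5), (8, 5), (0, 3)}"

lemma G21_no_vectors:
  assumes len: "\<And>v. length (x v) = 4"
    and dot: "\<And>u v. (u, v) \<in> set G21_edges \<Longrightarrow> dot (x u) (x v) \<longleftrightarrow> (u, v) \<in> G21_flipped"
  shows False
proof -
  have V: "x v \<in> set (List.n_lists 4 [False, True])" for v
    using len by (auto simp: set_n_lists)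
  have d:
    "\<not> dot (x 0) (x 2)" "\<not> dot (x 0) (x 4)" "\<not> dot (x 2) (x 4)" "dot (x 0) (x 3)"
    "\<not> dot (x 2) (x 3)" "dot (x 4) (x 3)" "\<not> dot (x 0) (x 1)" "dot (x 1) (x 2)"
    "\<not> dot (x 1) (x 8)" "\<not> dot (x 8) (x 2)" "\<not> dot (x 8) (x 4)" "\<not> dot (x 0) (x 5)"
    "dot (x 8) (x 5)" "\<not> dot (x 4) (x 5)" "\<not> dot (x 0) (x 6)" "\<not> dot (x 6) (x 1)"
    "\<not> dot (x 6) (x 8)" "dot (x 6) (x 5)" "\<not> dot (x 0) (x 7)" "dot (x 7) (x 1)"
    "\<not> dot (x 7) (x 6)"
    by (simp_all add: dot G21_edges_def G21_flipped_def)
  have "G21_vectors_exist (List.n_lists 4 [False, True])"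
    unfolding G21_vectors_exist_def list_ex_iff
    \<comment> \<open>The witnesses follow the nesting order. The choice for vertex 3 is a closed
      branch, finished before the one for vertex 1 starts.\<close>
    by (rule bexI[OF _ V[of 0]],
        rule bexI[OF _ V[of 2]], (intro conjI d)?,
        rule bexI[OF _ V[of 4]], (intro conjI d)?,
        rule bexI[OF _ V[of 3]], (intro conjI d)?,
        rule bexI[OF _ V[of 1]], (intro conjI d)?,
        rule bexI[OF _ V[of 8]], (intro conjI d)?,
        rule bexI[OF _ V[of 5]], (intro conjI d)?,
        rule bexI[OF _ V[of 6]], (intro conjI d)?,
        rule bexI[OF _ V[of 7]], (intro conjI d)?)
  then show False using not_G21_vectors_exist by contradiction
qed

theorem proposition8p6:
  shows "graph_diameter (inversion_graph G21) \<ge> 5"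
proof -
  \<comment> \<open>\<open>G21_edges\<close> lists every edge in one direction only, so it serves as
    the first orientation.\<close>
  define E where "E = set G21_edges"
  define D where "D = \<lparr>pverts = {0..8::nat}, parcs = E\<rparr>"
  define D' where "D' = \<lparr>pverts = {0..8::nat}, parcs = (E - G21_flipped) \<union> G21_flipped\<inverse>\<rparr>"
  have one_way: "E \<inter> E\<inverse> = {}"
    by (simp add: E_def G21_edges_def)
  have flipped: "G21_flipped \<subseteq> E"
    by (simp add: E_def G21_edges_def G21_flipped_def)
  have G: "pverts G21 = {0..8}" "parcs G21 = E \<union> E\<inverse>"
    by (simp_all add: E_def G21_def)
  have D: "orientation_of G21 D"
    by (rule orientation_ofI) (simp_all add: D_def G one_way)
  have D': "orientation_of G21 D'"
  proof (rule orientation_ofI)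
    show "parcs D' \<union> (parcs D')\<inverse> = parcs G21"
      using flipped by (auto simp: D'_def G)
    show "parcs D' \<inter> (parcs D')\<inverse> = {}"
      using one_way flipped by (auto simp: D'_def)
  qed (simp add: D'_def G)
  \<comment> \<open>The restriction to \<open>E\<close> matters: \<open>D\<close> and
    \<open>D'\<close> also differ on the reverses of flipped arcs, which lie outside
    \<open>G21_flipped\<close>.\<close>
  have diff: "((u, v) \<in> parcs D) \<noteq> ((u, v) \<in> parcs D') \<longleftrightarrow> (u, v) \<in> G21_flipped"
    if "(u, v) \<in> E" for u v
    using that one_way flipped by (auto simp: D_def D'_def)
  have "ereal (Suc 4) \<le> graph_diameter (inversion_graph G21)"
  proof (rule graph_diameter_inversion_graph_ge[OF pair_graph_G21 D D'], intro notI, elim exE conjE)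
    fix x assume len: "\<forall>v. length (x v) = 4"
      and dot: "\<forall>(u, v) \<in> parcs G21.
        dot (x u) (x v) \<longleftrightarrow> ((u, v) \<in> parcs D) \<noteq> ((u, v) \<in> parcs D')"
    have "dot (x u) (x v) \<longleftrightarrow> (u, v) \<in> G21_flipped" if uv: "(u, v) \<in> set G21_edges" for u v
    proof -
      have "(u, v) \<in> parcs G21"
        using uv by (simp add: G E_def)
      then show ?thesis
        using dot diff[of u v] uv unfolding E_def by blast
    qed
    with len show False using G21_no_vectors by blast
  qed
  then show ?thesis by simp
qed

end
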